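(* If $k = 2^a(8b+7)$ where $a$ and $b$ are nonnegative integers and $a$ is odd, then there does not exist a cyclic $S(2,k,3k(k-1)+k)$.
   Context: A Steiner 2-design of order $v$ and block-size $k$, denoted $S(2,k,v)$, consists of a set of $k$-subsets (called blocks) of a $v$-set (whose elements are called points) such that every pair of distinct points occurs in a unique block. An $S(2,k,v)$ is cyclic if there is a cyclic permutation of the $v$ points (a single $v$-cycle) that maps every block to a block. *)

theory Defs
  imports "HOL-Combinatorics.Orbits"
begin

definition steiner_2_design :: "'a set \<Rightarrow> 'a set set \<Rightarrow> nat \<Rightarrow> nat \<Rightarrow> bool" where
  "steiner_2_design V \<B> k v \<longleftrightarrow>
     finite V \<and> card V = v \<and>
     (\<forall>b\<in>\<B>. b \<subseteq> V \<and> card b = k) \<and>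
     (\<forall>x\<in>V. \<forall>y\<in>V. x \<noteq> y \<longrightarrow> (\<exists>!b. b \<in> \<B> \<and> x \<in> b \<and> y \<in> b))"

(* For permutations of V, cyclic_on \<sigma> V says that V is a single orbit,
   i.e. that \<sigma> is one cycle of length card V. *)
definition cyclic_steiner_2_design :: "'a set \<Rightarrow> 'a set set \<Rightarrow> nat \<Rightarrow> nat \<Rightarrow> bool" where
  "cyclic_steiner_2_design V \<B> k v \<longleftrightarrow>
     steiner_2_design V \<B> k v \<and>
     (\<exists>\<sigma>. \<sigma> permutes V \<and> cyclic_on \<sigma> V \<and> (\<forall>b\<in>\<B>. \<sigma> ` b \<in> \<B>))"

end

theory Submission
  imports Defs
begin

text \<open>
  Write $v = 3k(k-1)+k = k(3k-2)$ and let \<open>\<sigma>\<close> be the $v$-cycle.  The hypothesis makes $k$,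
  and with it $v$, even, so the points split into two parity classes interchanged by \<open>\<sigma>\<close>.
  Give them the signs $s = \pm 1$.

  A block fixed by a power of \<open>\<sigma>\<close> other than the identity is an orbit of \<open>\<sigma>\<close>$^{3k-2}$
  (\<open>short_block_mem_iff\<close>).  Such blocks are pairwise disjoint, so there are at most $3k-2$ of
  them.  All other blocks have $v$ distinct translates each, and the design has
  $3v + (3k-2)$ blocks altogether, so there are exactly three such orbits of blocks, and
  $3k-2$ short blocks.

  Let $w(B) = (\sum_{x \in B} s(x))^2$, which is constant on orbits of blocks.  Counting pairs
  of points (\<open>sum_blocks_power2\<close>) gives $\sum_B w(B) = 3kv$, because $\sum_x s(x) = 0$.  As
  $3k-2$ is even, $s$ is constant on each short block, so the short blocks contribute
  $(3k-2)k^2 = kv$.  The three remaining orbits contribute $v(y_1^2+y_2^2+y_3^2)$, whence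
  $y_1^2+y_2^2+y_3^2 = 2k$ (\<open>three_squares\<close>).  For the given $k$ and odd $a$ the number $2k$ has
  the form $4^m(8b+7)$, which is never a sum of three squares.
\<close>

section \<open>Sums of three squares\<close>

lemma power2_mod_8:
  fixes x :: int
  shows "x\<^sup>2 mod 8 \<in> {0, 1, 4}"
proof -
  have "x mod 8 \<in> {0, 1, 2, 3, 4, 5, 6, 7}" by auto
  moreover have "x\<^sup>2 mod 8 = (x mod 8)\<^sup>2 mod 8" by (simp add: power_mod)
  ultimately show ?thesis by auto
qed

lemma even_if_4_dvd_three_squares:
  fixes x y z :: int
  assumes "4 dvd x\<^sup>2 + y\<^sup>2 + z\<^sup>2"
  shows "even x" "even y" "even z"
proof -
  have sq: "t\<^sup>2 mod 4 = (if even t then 0 else 1)" for t :: int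
  proof -
    have "t mod 4 \<in> {0, 1, 2, 3}" by auto
    moreover have "t\<^sup>2 mod 4 = (t mod 4)\<^sup>2 mod 4" by (simp add: power_mod)
    moreover have "even t \<longleftrightarrow> even (t mod 4)" by presburger
    ultimately show ?thesis by auto
  qed
  have "(a mod 4 + b mod 4 + c mod 4) mod 4 = 0" if "4 dvd a + b + c" for a b c :: int
    using that by presburger
  from this[OF assms] show "even x" "even y" "even z"
    unfolding sq by (auto split: if_splits)
qed

lemma not_sum_of_three_squares:
  fixes x y z :: int and b m :: nat
  shows "x\<^sup>2 + y\<^sup>2 + z\<^sup>2 \<noteq> 4 ^ m * (8 * int b + 7)"
proof (induction m arbitrary: x y z)
  case 0
  show ?case
  proof
    assume "x\<^sup>2 + y\<^sup>2 + z\<^sup>2 = 4 ^ 0 * (8 * int b + 7)"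
    then have "(x\<^sup>2 mod 8 + y\<^sup>2 mod 8 + z\<^sup>2 mod 8) mod 8 = 7"
      by (simp add: mod_simps) presburger
    then show False
      using power2_mod_8[of x] power2_mod_8[of y] power2_mod_8[of z] by auto
  qed
next
  case (Suc m)
  show ?case
  proof
    assume eq: "x\<^sup>2 + y\<^sup>2 + z\<^sup>2 = 4 ^ Suc m * (8 * int b + 7)"
    then have "4 dvd x\<^sup>2 + y\<^sup>2 + z\<^sup>2" by simp
    then obtain x' y' z' where "x = 2 * x'" "y = 2 * y'" "z = 2 * z'"
      using even_if_4_dvd_three_squares by (meson evenE)
    with eq have "x'\<^sup>2 + y'\<^sup>2 + z'\<^sup>2 = 4 ^ m * (8 * int b + 7)"
      by (simp add: power_mult_distrib)
    with Suc show False by blast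
  qed
qed

section \<open>Free orbits of a single map\<close>

text \<open>If every cycle of \<open>f\<close> on the finite set \<open>F\<close> has length exactly \<open>v\<close>, then \<open>F\<close> is a disjoint
  union of such cycles, and \<open>Q\<close> below is a set of representatives.\<close>

lemma free_orbit_representatives:
  fixes f :: "'b \<Rightarrow> 'b" and w :: "'b \<Rightarrow> int"
  assumes "finite F" and "0 < v"
    and "\<And>A. A \<in> F \<Longrightarrow> f A \<in> F"
    and "\<And>A n. A \<in> F \<Longrightarrow> (f ^^ n) A = A \<longleftrightarrow> v dvd n"
    and "\<And>A. A \<in> F \<Longrightarrow> w (f A) = w A"
  shows "\<exists>Q\<subseteq>F. card F = v * card Q \<and> (\<Sum>A\<in>F. w A) = int v * (\<Sum>A\<in>Q. w A)"
  using assms(1,3-)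
proof (induction F rule: finite_psubset_induct)
  case (psubset F)
  show ?case
  proof (cases "F = {}")
    case True
    then show ?thesis by auto
  next
    case False
    then obtain A where A: "A \<in> F" by blast
    have pow_F: "(f ^^ n) C \<in> F" if "C \<in> F" for n C
      using that by (induction n) (auto intro: psubset.prems)
    have pow_w: "w ((f ^^ n) A) = w A" for n
      by (induction n) (auto simp: psubset.prems(3) pow_F A)
    have period: "(f ^^ v) C = C" if "C \<in> F" for C
      using psubset.prems(2)[OF that] by simp
    define Orb where "Orb = (\<lambda>n. (f ^^ n) A) ` {..<v}"
    have mem_Orb: "(f ^^ n) A \<in> Orb" for n
      unfolding Orb_def using funpow_mod_eq[OF period[OF A], of n] \<open>0 < v\<close>
      by (auto intro!: image_eqI[of _ _ "n mod v"])
    have inj: "inj_on (\<lambda>n. (f ^^ n) A) {..<v}"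
    proof (rule linorder_inj_onI)
      fix m n assume mn: "m < n" "m \<in> {..<v}" "n \<in> {..<v}"
      show "(f ^^ m) A \<noteq> (f ^^ n) A"
      proof
        assume eq: "(f ^^ m) A = (f ^^ n) A"
        have "(f ^^ (v - m + n)) A = (f ^^ (v - m)) ((f ^^ n) A)"
          by (simp add: funpow_add)
        also have "\<dots> = (f ^^ (v - m + m)) A"
          by (simp add: funpow_add flip: eq)
        also have "\<dots> = A" using mn period[OF A] by simp
        finally have "v dvd v - m + n" using psubset.prems(2)[OF A] by blast
        moreover have "v - m + n = v + (n - m)" using mn by simp
        ultimately have "v dvd n - m" by simp
        with mn show False by (auto dest: dvd_imp_le)
      qed
    qed auto
    have card_Orb: "card Orb = v" unfolding Orb_def using card_image[OF inj] by simp
    have Orb_F: "Orb \<subseteq> F" unfolding Orb_def using pow_F A by auto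
    have A_Orb: "A \<in> Orb" using mem_Orb[of 0] by simp
    have finO: "finite Orb" unfolding Orb_def by simp
    have closed: "f C \<in> F - Orb" if "C \<in> F - Orb" for C
    proof -
      have "f C \<notin> Orb"
      proof
        assume "f C \<in> Orb"
        then obtain n where n: "f C = (f ^^ n) A" unfolding Orb_def by blast
        have "C = (f ^^ (Suc (v - 1))) C" using period that \<open>0 < v\<close> by simp
        also have "\<dots> = (f ^^ (v - 1)) (f C)" by (simp only: funpow_Suc_right o_apply)
        also have "\<dots> = (f ^^ (v - 1 + n)) A" by (simp add: n funpow_add)
        finally have "C \<in> Orb" using mem_Orb by metis
        with that show False by blast
      qed
      with that psubset.prems(1) show ?thesis by blast
    qed
    have "F - Orb \<subset> F" using A A_Orb by blast
    from psubset.IH[OF this] closed psubset.prems(2,3)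
    obtain Q where Q: "Q \<subseteq> F - Orb" "card (F - Orb) = v * card Q"
      "(\<Sum>C\<in>F - Orb. w C) = int v * (\<Sum>C\<in>Q. w C)"
      by (metis DiffD1)
    have finQ: "finite Q" and AQ: "A \<notin> Q"
      using Q(1) psubset.hyps A_Orb by (auto intro: finite_subset)
    have "(\<Sum>C\<in>Orb. w C) = int v * w A"
      unfolding Orb_def by (subst sum.reindex[OF inj]) (simp add: pow_w)
    then have "(\<Sum>C\<in>F. w C) = int v * (\<Sum>C\<in>insert A Q. w C)"
      using sum.subset_diff[OF Orb_F psubset.hyps, of w] Q(3) finQ AQ
      by (simp add: algebra_simps)
    moreover have "card F = v * card (insert A Q)"
      using card_Diff_subset[OF finO Orb_F] card_mono[OF psubset.hyps Orb_F] Q(2) card_Orb finQ AQ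
      by simp
    moreover have "insert A Q \<subseteq> F" using Q(1) A by blast
    ultimately show ?thesis by blast
  qed
qed

lemma cyclic_funpow_eq_self_iff:
  assumes "f permutes S" "finite S" "cyclic_on f S" "x \<in> S"
  shows "(f ^^ n) x = x \<longleftrightarrow> card S dvd n"
proof -
  have S: "orbit f x = S" using assms(3,4) by (rule orbit_cyclic_eq3)
  then have self: "x \<in> orbit f x" using assms(4) by simp
  define p where "p = funpow_dist1 f x x"
  have inj: "inj_on (\<lambda>n. (f ^^ n) x) {0..<p}"
    unfolding p_def by (rule inj_on_funpow_dist1[OF self])
  have "S = (\<lambda>n. (f ^^ n) x) ` {0..<p}"
    using orbit_conv_funpow_dist1[OF self] S by (simp add: p_def)
  then have p: "card S = p" using card_image[OF inj] by simp
  have per: "(f ^^ p) x = x" unfolding p_def by (rule funpow_dist1_prop[OF self])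
  have "0 < p" unfolding p_def by simp
  have "(f ^^ n) x = x \<longleftrightarrow> (f ^^ (n mod p)) x = (f ^^ 0) x"
    using funpow_mod_eq[OF per] by simp
  also have "\<dots> \<longleftrightarrow> n mod p = 0"
    using inj_on_eq_iff[OF inj, of "n mod p" 0] \<open>0 < p\<close> by simp
  finally show ?thesis using p by (simp add: dvd_eq_mod_eq_0)
qed

section \<open>Counting in a Steiner 2-design\<close>

locale steiner_design =
  fixes V :: "'a set" and \<B> :: "'a set set" and k v :: nat
  assumes design: "steiner_2_design V \<B> k v"
begin

lemma finite_V: "finite V" and card_V: "card V = v"
  and block_subset: "B \<in> \<B> \<Longrightarrow> B \<subseteq> V" and card_block: "B \<in> \<B> \<Longrightarrow> card B = k"
  using design unfolding steiner_2_design_def by auto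

lemma unique_block:
  "x \<in> V \<Longrightarrow> y \<in> V \<Longrightarrow> x \<noteq> y \<Longrightarrow> \<exists>!B. B \<in> \<B> \<and> x \<in> B \<and> y \<in> B"
  using design unfolding steiner_2_design_def by blast

lemma block_eqI:
  assumes "B \<in> \<B>" "C \<in> \<B>" "x \<in> B" "y \<in> B" "x \<in> C" "y \<in> C" "x \<noteq> y"
  shows "B = C"
  using unique_block[of x y] assms block_subset by blast

lemma finite_block: "B \<in> \<B> \<Longrightarrow> finite B"
  using block_subset finite_V finite_subset by blast

lemma finite_blocks: "finite \<B>"
  by (rule finite_subset[of _ "Pow V"]) (use block_subset finite_V in auto)

lemma replication:
  assumes "x \<in> V"
  shows "card {B \<in> \<B>. x \<in> B} * (k - 1) = v - 1"
proof -
  let ?I = "{B \<in> \<B>. x \<in> B}"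
  have "V - {x} = (\<Union>B\<in>?I. B - {x})"
  proof (intro equalityI subsetI)
    fix y assume "y \<in> V - {x}"
    then show "y \<in> (\<Union>B\<in>?I. B - {x})"
      using unique_block[of x y] assms by blast
  qed (use block_subset in blast)
  moreover have "card (\<Union>B\<in>?I. B - {x}) = (\<Sum>B\<in>?I. card (B - {x}))"
  proof (rule card_UN_disjoint)
    show "\<forall>B\<in>?I. \<forall>C\<in>?I. B \<noteq> C \<longrightarrow> (B - {x}) \<inter> (C - {x}) = {}"
      using block_eqI by blast
  qed (use finite_blocks finite_block in auto)
  moreover have "\<dots> = card ?I * (k - 1)" by (simp add: card_block)
  moreover have "card (V - {x}) = v - 1"
    using assms card_V by simp
  ultimately show ?thesis by simp
qed

text \<open>Expanding the squares, a product \<open>s x * s y\<close> is counted once for each block through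
  \<open>x\<close> and \<open>y\<close>: that is \<open>r\<close> times if \<open>x = y\<close>, and once otherwise.\<close>

lemma sum_blocks_power2:
  fixes s :: "'a \<Rightarrow> int" and r :: nat
  assumes r: "\<And>x. x \<in> V \<Longrightarrow> card {B \<in> \<B>. x \<in> B} = r"
  shows "(\<Sum>B\<in>\<B>. (\<Sum>x\<in>B. s x)\<^sup>2) = (int r - 1) * (\<Sum>x\<in>V. (s x)\<^sup>2) + (\<Sum>x\<in>V. s x)\<^sup>2"
proof -
  have restrict: "(\<Sum>x\<in>B. g x) = (\<Sum>x\<in>V. if x \<in> B then g x else 0)"
    if "B \<in> \<B>" for B and g :: "'a \<Rightarrow> int"
    using block_subset[OF that] finite_V by (simp add: sum.If_cases Int_absorb1)
  have "(\<Sum>B\<in>\<B>. (\<Sum>x\<in>B. s x)\<^sup>2) =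
      (\<Sum>B\<in>\<B>. \<Sum>x\<in>V. \<Sum>y\<in>V. if x \<in> B \<and> y \<in> B then s x * s y else 0)"
    by (rule sum.cong[OF refl])
      (auto simp: power2_eq_square restrict sum_product intro!: sum.cong)
  also have "\<dots> = (\<Sum>x\<in>V. \<Sum>y\<in>V. \<Sum>B\<in>\<B>. if x \<in> B \<and> y \<in> B then s x * s y else 0)"
    by (subst sum.swap, rule sum.cong[OF refl], subst sum.swap, rule refl)
  also have "\<dots> = (\<Sum>x\<in>V. \<Sum>y\<in>V. s x * s y + (if x = y then (int r - 1) * (s x)\<^sup>2 else 0))"
  proof (intro sum.cong refl)
    fix x y assume xy: "x \<in> V" "y \<in> V"
    have "(\<Sum>B\<in>\<B>. if x \<in> B \<and> y \<in> B then s x * s y else 0)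
        = int (card {B \<in> \<B>. x \<in> B \<and> y \<in> B}) * (s x * s y)"
      using finite_blocks by (simp add: sum.If_cases Int_def)
    moreover have "card {B \<in> \<B>. x \<in> B \<and> y \<in> B} = (if x = y then r else 1)"
    proof (cases "x = y")
      case False
      then obtain B where "{B \<in> \<B>. x \<in> B \<and> y \<in> B} = {B}"
        using unique_block[OF xy] by blast
      with False show ?thesis by simp
    qed (simp add: r xy)
    ultimately show "(\<Sum>B\<in>\<B>. if x \<in> B \<and> y \<in> B then s x * s y else 0)
        = s x * s y + (if x = y then (int r - 1) * (s x)\<^sup>2 else 0)"
      by (simp add: power2_eq_square algebra_simps)
  qed
  also have "\<dots> = (int r - 1) * (\<Sum>x\<in>V. (s x)\<^sup>2) + (\<Sum>x\<in>V. s x)\<^sup>2"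
    unfolding power2_eq_square sum_product
    using finite_V by (simp add: sum.distrib sum_distrib_left)
  finally show ?thesis .
qed

end

section \<open>Short and full blocks of a cyclic design\<close>

locale cyclic_design = steiner_design +
  fixes \<sigma> :: "'a \<Rightarrow> 'a"
  assumes perm: "\<sigma> permutes V" and cyc: "cyclic_on \<sigma> V"
    and image_block: "B \<in> \<B> \<Longrightarrow> \<sigma> ` B \<in> \<B>"
begin

lemma v_pos: "0 < v"
  using cyc finite_V card_V by (auto simp: cyclic_on_def card_gt_0_iff)

lemma funpow_V: "x \<in> V \<Longrightarrow> (\<sigma> ^^ n) x \<in> V"
  using cyclic_on_funpow_in[OF cyc] .

lemma inj_funpow: "inj (\<sigma> ^^ n)"
  using permutes_inj[OF perm] by (rule inj_fn)

lemma funpow_eq_self_iff: "x \<in> V \<Longrightarrow> (\<sigma> ^^ n) x = x \<longleftrightarrow> v dvd n"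
  using cyclic_funpow_eq_self_iff[OF perm finite_V cyc] card_V by simp

lemma reachable:
  assumes "x \<in> V" "y \<in> V"
  obtains n where "y = (\<sigma> ^^ n) x"
  using orbit_cyclic_eq3[OF cyc assms(1)] assms(2) by (auto simp: orbit_altdef)

lemma image_funpow_block: "B \<in> \<B> \<Longrightarrow> (\<sigma> ^^ n) ` B \<in> \<B>"
proof (induction n)
  case (Suc n)
  then have "\<sigma> ` ((\<sigma> ^^ n) ` B) \<in> \<B>" by (intro image_block)
  then show ?case by (simp add: image_comp)
qed simp

lemma image_funpow: "((`) \<sigma> ^^ n) B = (\<sigma> ^^ n) ` B"
  by (induction n) (auto simp: image_comp)

lemma image_funpow_eq_self: "B \<in> \<B> \<Longrightarrow> v dvd n \<Longrightarrow> (\<sigma> ^^ n) ` B = B"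
proof -
  assume "B \<in> \<B>" "v dvd n"
  then have "(\<sigma> ^^ n) x = x" if "x \<in> B" for x
    using that block_subset funpow_eq_self_iff[of x n] by blast
  then show ?thesis by simp
qed

text \<open>The blocks whose orbit under \<open>\<sigma>\<close> has fewer than \<open>v\<close> elements.\<close>

definition short_blocks :: "'a set set" where
  "short_blocks = {B \<in> \<B>. \<exists>n. (\<sigma> ^^ n) ` B = B \<and> \<not> v dvd n}"

lemma short_blocks_subset: "short_blocks \<subseteq> \<B>"
  unfolding short_blocks_def by blast

text \<open>If a nontrivial power \<open>\<sigma> ^^ m\<close> fixes \<open>B\<close>, then \<open>B\<close> is an orbit of its own stabiliser:
  when \<open>x\<close> and \<open>(\<sigma> ^^ n) x\<close> lie in \<open>B\<close>, the blocks \<open>B\<close> and \<open>(\<sigma> ^^ n) ` B\<close> have two distinct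
  points in common, \<open>(\<sigma> ^^ n) x\<close> and its image under \<open>\<sigma> ^^ m\<close>.\<close>

lemma short_block_funpow_mem_iff:
  assumes B: "B \<in> \<B>" "(\<sigma> ^^ m) ` B = B" "\<not> v dvd m" and x: "x \<in> B"
  shows "(\<sigma> ^^ n) x \<in> B \<longleftrightarrow> (\<sigma> ^^ n) ` B = B"
proof
  assume nx: "(\<sigma> ^^ n) x \<in> B"
  let ?x = "(\<sigma> ^^ n) x" and ?y = "(\<sigma> ^^ m) ((\<sigma> ^^ n) x)"
  have xV: "x \<in> V" using B(1) x block_subset by blast
  have y: "?y = (\<sigma> ^^ n) ((\<sigma> ^^ m) x)"
    by (metis add.commute comp_apply funpow_add)
  have "?x \<noteq> ?y" using funpow_eq_self_iff[OF funpow_V[OF xV]] B(3) by metis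
  moreover have "?y \<in> B" using nx B(2) by blast
  moreover have "?y \<in> (\<sigma> ^^ n) ` B" unfolding y using x B(2) by blast
  ultimately show "(\<sigma> ^^ n) ` B = B"
    using block_eqI[of "(\<sigma> ^^ n) ` B" B ?x ?y] image_funpow_block B(1) nx x by blast
qed (use x in blast)

text \<open>The exponents of the stabiliser of \<open>B\<close> are the multiples of their least positive element
  \<open>d\<close>.  Hence \<open>B\<close> has \<open>v / d\<close> points, and \<open>d = q\<close>.\<close>

lemma short_block_mem_iff:
  assumes B: "B \<in> short_blocks" and x: "x \<in> B" and v: "v = k * q"
  shows "(\<sigma> ^^ n) x \<in> B \<longleftrightarrow> q dvd n"
proof -
  obtain m where m: "B \<in> \<B>" "(\<sigma> ^^ m) ` B = B" "\<not> v dvd m"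
    using B unfolding short_blocks_def by blast
  define M where "M = {n. (\<sigma> ^^ n) x \<in> B}"
  have M: "n \<in> M \<longleftrightarrow> (\<sigma> ^^ n) ` B = B" for n
    unfolding M_def using short_block_funpow_mem_iff[OF m x] by simp
  have xV: "x \<in> V" using m(1) x block_subset by blast
  have v_M: "v \<in> M" using M image_funpow_eq_self[OF m(1)] by simp
  define d where "d = (LEAST n. 0 < n \<and> n \<in> M)"
  have d: "0 < d" "d \<in> M"
    using LeastI[of "\<lambda>n. 0 < n \<and> n \<in> M" v] v_pos v_M unfolding d_def by auto
  have d_min: "d \<le> n" if "0 < n" "n \<in> M" for n
    unfolding d_def using that by (auto intro: Least_le)
  have add_M: "n + n' \<in> M \<longleftrightarrow> n \<in> M" if "n' \<in> M" for n n'
    using that unfolding M funpow_add image_comp[symmetric] by simp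
  have mult_M: "n + i * d \<in> M \<longleftrightarrow> n \<in> M" for n i
  proof (induction i)
    case (Suc i)
    then show ?case using add_M[OF d(2), of "n + i * d"] by (simp add: algebra_simps)
  qed simp
  have dvd_M: "n \<in> M \<longleftrightarrow> d dvd n" for n
  proof -
    have "n \<in> M \<longleftrightarrow> n mod d \<in> M"
      using mult_M[of "n mod d" "n div d"] by simp
    also have "\<dots> \<longleftrightarrow> n mod d = 0"
      using d_min[of "n mod d"] mod_less_divisor[OF d(1), of n] x
      by (cases "n mod d = 0") (auto simp: M_def)
    finally show ?thesis by (simp add: dvd_eq_mod_eq_0)
  qed
  obtain e where e: "v = d * e" using v_M dvd_M by (auto elim: dvdE)
  have "bij_betw (\<lambda>i. (\<sigma> ^^ (i * d)) x) {..<e} B"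
    unfolding bij_betw_def
  proof
    show "inj_on (\<lambda>i. (\<sigma> ^^ (i * d)) x) {..<e}"
    proof (rule linorder_inj_onI)
      fix i j assume ij: "i < j" "i \<in> {..<e}" "j \<in> {..<e}"
      show "(\<sigma> ^^ (i * d)) x \<noteq> (\<sigma> ^^ (j * d)) x"
      proof
        assume "(\<sigma> ^^ (i * d)) x = (\<sigma> ^^ (j * d)) x"
        also have "j * d = i * d + (j - i) * d" using ij by (simp flip: add_mult_distrib)
        also have "(\<sigma> ^^ (i * d + (j - i) * d)) x = (\<sigma> ^^ (i * d)) ((\<sigma> ^^ ((j - i) * d)) x)"
          by (simp add: funpow_add)
        finally have "(\<sigma> ^^ ((j - i) * d)) x = x" using inj_funpow by (metis injD)
        then have "e dvd j - i"
          using funpow_eq_self_iff[OF xV] e d(1) by (simp add: mult.commute)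
        with ij show False by (auto dest: dvd_imp_le)
      qed
    qed auto
    show "(\<lambda>i. (\<sigma> ^^ (i * d)) x) ` {..<e} = B"
    proof (intro equalityI subsetI)
      fix y assume "y \<in> (\<lambda>i. (\<sigma> ^^ (i * d)) x) ` {..<e}"
      then obtain i where "y = (\<sigma> ^^ (i * d)) x" by blast
      moreover have "i * d \<in> M" unfolding dvd_M by simp
      ultimately show "y \<in> B" unfolding M_def by blast
    next
      fix y assume y: "y \<in> B"
      then obtain n where n: "y = (\<sigma> ^^ n) x"
        using reachable xV m(1) block_subset by blast
      let ?n = "n mod v"
      have y': "y = (\<sigma> ^^ ?n) x"
        using n funpow_mod_eq[of v \<sigma> x n] funpow_eq_self_iff[OF xV, of v] by (metis dvd_refl)
      with y have "d dvd ?n" using dvd_M M_def by blast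
      then obtain i where i: "?n = i * d" by (metis dvdE mult.commute)
      have "?n < v" using v_pos by simp
      then have "i < e" using i e by (simp add: mult.commute)
      with y' i show "y \<in> (\<lambda>i. (\<sigma> ^^ (i * d)) x) ` {..<e}" by auto
    qed
  qed
  then have "k = e" using card_block[OF m(1)] by (auto dest: bij_betw_same_card)
  then have "d = q" using v e v_pos by auto
  then show ?thesis using dvd_M unfolding M_def by auto
qed

text \<open>Two short blocks with a common point coincide, so the short blocks pack into \<open>V\<close>.\<close>

lemma card_short_blocks_le:
  assumes v: "v = k * q"
  shows "card short_blocks \<le> q"
proof -
  have sub: "B \<subseteq> C" if "B \<in> short_blocks" "C \<in> short_blocks" "x \<in> B" "x \<in> C" for B C x
  proof
    fix y assume y: "y \<in> B"
    have "x \<in> V" "y \<in> V" using y that short_blocks_subset block_subset by blast+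
    then obtain n where "y = (\<sigma> ^^ n) x" by (rule reachable)
    with y show "y \<in> C"
      using short_block_mem_iff[OF _ _ v] that by blast
  qed
  have fin: "finite short_blocks"
    using short_blocks_subset finite_blocks by (rule finite_subset)
  have "card (\<Union> short_blocks) = (\<Sum>B\<in>short_blocks. card B)"
  proof (rule card_Union_disjoint)
    show "pairwise disjnt short_blocks"
      using sub by (auto simp: pairwise_def disjnt_def)
  qed (use finite_block short_blocks_subset in blast)
  also have "\<dots> = card short_blocks * k"
    using card_block short_blocks_subset by (simp add: subset_eq)
  finally have "card short_blocks * k \<le> k * q"
    using card_mono[OF finite_V, of "\<Union> short_blocks"] block_subset short_blocks_subset card_V v
    by auto
  then show ?thesis using v v_pos by (simp add: mult.commute)
qed

lemma full_block_representatives: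
  fixes w :: "'a set \<Rightarrow> int"
  assumes w: "\<And>B. B \<in> \<B> \<Longrightarrow> w (\<sigma> ` B) = w B"
  shows "\<exists>Q. finite Q \<and> card (\<B> - short_blocks) = v * card Q \<and>
    (\<Sum>B\<in>\<B> - short_blocks. w B) = int v * (\<Sum>B\<in>Q. w B)"
proof -
  let ?F = "\<B> - short_blocks"
  have fin: "finite ?F" using finite_blocks by simp
  have closed: "\<sigma> ` B \<in> ?F" if B: "B \<in> ?F" for B
  proof -
    have "v dvd n" if "(\<sigma> ^^ n) ` (\<sigma> ` B) = \<sigma> ` B" for n
    proof -
      have "\<sigma> ` ((\<sigma> ^^ n) ` B) = (\<sigma> ^^ n) ` (\<sigma> ` B)"
        by (simp add: image_image funpow_swap1)
      also have "\<dots> = \<sigma> ` B" by (rule that)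
      finally have "(\<sigma> ^^ n) ` B = B"
        using inj_image_eq_iff[OF permutes_inj[OF perm]] by simp
      with B show "v dvd n" unfolding short_blocks_def by blast
    qed
    with B image_block show ?thesis unfolding short_blocks_def by blast
  qed
  have free: "((`) \<sigma> ^^ n) B = B \<longleftrightarrow> v dvd n" if "B \<in> ?F" for B n
    using that image_funpow_eq_self unfolding image_funpow short_blocks_def by blast
  obtain Q where "Q \<subseteq> ?F" "card ?F = v * card Q"
    "(\<Sum>B\<in>?F. w B) = int v * (\<Sum>B\<in>Q. w B)"
    using free_orbit_representatives[OF fin v_pos closed free, of w] w by auto
  with fin show ?thesis using finite_subset by blast
qed

section \<open>Parity of points\<close>

text \<open>With an even number of points, the parity of the exponent of \<open>\<sigma>\<close> leading from a base
  point to \<open>x\<close> is well defined.\<close>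

lemma alternating_sign:
  assumes "even v"
  obtains s :: "'a \<Rightarrow> int" where
    "\<And>x. x \<in> V \<Longrightarrow> s (\<sigma> x) = - s x" "\<And>x. (s x)\<^sup>2 = 1"
proof -
  obtain x0 where x0: "x0 \<in> V" using v_pos card_V by (metis card.empty less_irrefl all_not_in_conv)
  have parity: "even m \<longleftrightarrow> even n" if "(\<sigma> ^^ m) x0 = (\<sigma> ^^ n) x0" for m n
    using that
  proof (induction m n rule: linorder_wlog)
    case (le m n)
    then have "(\<sigma> ^^ m) x0 = (\<sigma> ^^ m) ((\<sigma> ^^ (n - m)) x0)"
      by (metis comp_apply funpow_add le_add_diff_inverse)
    then have "(\<sigma> ^^ (n - m)) x0 = x0" using inj_funpow by (metis injD)
    then have "even (n - m)" using funpow_eq_self_iff[OF x0] assms by (meson dvd_trans)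
    then show ?case using le(1) by auto
  qed metis
  define e where "e x = (SOME n. (\<sigma> ^^ n) x0 = x)" for x
  have e: "(\<sigma> ^^ e x) x0 = x" if "x \<in> V" for x
    unfolding e_def using reachable[OF x0 that] by (metis (mono_tags) someI)
  define s :: "'a \<Rightarrow> int" where "s x = (- 1) ^ e x" for x
  show ?thesis
  proof
    fix x assume x: "x \<in> V"
    then have "(\<sigma> ^^ e (\<sigma> x)) x0 = (\<sigma> ^^ Suc (e x)) x0"
      using e[of "\<sigma> x"] e[of x] cyclic_on_inI[OF cyc] by simp
    from parity[OF this] show "s (\<sigma> x) = - s x"
      unfolding s_def by (auto simp: minus_one_power_iff)
  qed (simp add: s_def flip: power_mult)
qed

text \<open>There are exactly three full orbits of blocks.  The numbers \<open>x\<close>, \<open>y\<close> and \<open>z\<close> are the sums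
  of the signs of the points in a representative of each.\<close>

theorem three_squares:
  assumes v: "v = k * (3 * k - 2)" and k: "even k" "2 \<le> k"
  shows "\<exists>x y z :: int. x\<^sup>2 + y\<^sup>2 + z\<^sup>2 = 2 * int k"
proof -
  define q where "q = 3 * k - 2"
  have vq: "v = k * q" using v q_def by simp
  have q_int: "int q = 3 * int k - 2" using k unfolding q_def by simp
  have q: "0 < q" "even q" "q < v"
    using k unfolding q_def vq by auto
  obtain s :: "'a \<Rightarrow> int" where s: "\<And>x. x \<in> V \<Longrightarrow> s (\<sigma> x) = - s x" "\<And>x. (s x)\<^sup>2 = 1"
    using alternating_sign[of thesis] vq q(2) by fastforce
  define w where "w B = (\<Sum>x\<in>B. s x)\<^sup>2" for B
  have sum_image: "(\<Sum>x\<in>\<sigma> ` A. s x) = - (\<Sum>x\<in>A. s x)" if "A \<subseteq> V" for A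
    using that s(1) permutes_inj_on[OF perm]
    by (subst sum.reindex) (auto simp: sum_negf[symmetric] subset_eq)
  have w: "w (\<sigma> ` B) = w B" if "B \<in> \<B>" for B
    unfolding w_def using sum_image[OF block_subset[OF that]] by simp
  have sum_V: "(\<Sum>x\<in>V. s x) = 0"
    using sum_image[of V] permutes_image[OF perm] by simp
  have r: "card {B \<in> \<B>. x \<in> B} = 3 * k + 1" if "x \<in> V" for x
  proof -
    have "int (v - 1) = int k * int q - 1"
      using v_pos by (simp add: of_nat_diff flip: vq) (simp add: vq)
    also have "\<dots> = (3 * int k + 1) * (int k - 1)"
      by (simp add: q_int algebra_simps)
    also have "\<dots> = int ((3 * k + 1) * (k - 1))"
      using k(2) by (simp only: of_nat_mult of_nat_add of_nat_diff) simp
    finally have "card {B \<in> \<B>. x \<in> B} * (k - 1) = (3 * k + 1) * (k - 1)"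
      using replication[OF that] by linarith
    then show ?thesis using k(2) by (simp only: mult_cancel2) simp
  qed
  have "int k * int k * int (card \<B>) = int k * int k * (3 * int v + int q)"
    using sum_blocks_power2[OF r, of "\<lambda>_. 1"] card_block card_V
    by (simp add: vq q_int power2_eq_square algebra_simps)
  then have "int (card \<B>) = 3 * int v + int q"
    using k by simp
  then have card_blocks: "card \<B> = 3 * v + q" by linarith
  have sum_w: "(\<Sum>B\<in>\<B>. w B) = 3 * int k * int v"
    using sum_blocks_power2[OF r, of s] sum_V s(2) card_V unfolding w_def by simp
  obtain Q where Q: "finite Q" "card (\<B> - short_blocks) = v * card Q"
    "(\<Sum>B\<in>\<B> - short_blocks. w B) = int v * (\<Sum>B\<in>Q. w B)"
    using full_block_representatives[of w] w by blast
  have fin: "finite short_blocks"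
    using short_blocks_subset finite_blocks by (rule finite_subset)
  have total: "card short_blocks + v * card Q = 3 * v + q"
    using card_Diff_subset[OF fin short_blocks_subset] Q(2) card_blocks
      card_mono[OF finite_blocks short_blocks_subset] by simp
  \<comment> \<open>The number of short blocks is congruent to \<open>q\<close> modulo \<open>v\<close>, and both are less than \<open>v\<close>.\<close>
  have "card short_blocks < v" using card_short_blocks_le[OF vq] q(3) by simp
  moreover have "card short_blocks mod v = q mod v"
    using arg_cong[OF total, of "\<lambda>n. n mod v"] by simp
  ultimately have short: "card short_blocks = q" using q(3) by simp
  with total v_pos have card_Q: "card Q = 3" by simp
  have "w B = (int k)\<^sup>2" if B: "B \<in> short_blocks" for B
  proof -
    have B': "B \<in> \<B>" using B short_blocks_subset by blast
    with k have "B \<noteq> {}" using card_block by fastforce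
    then obtain x where x: "x \<in> B" by blast
    then have "x \<in> V" using B' block_subset by blast
    then have pow: "s ((\<sigma> ^^ n) x) = (- 1) ^ n * s x" for n
      by (induction n) (auto simp: s(1) funpow_V)
    have "s y = s x" if y: "y \<in> B" for y
    proof -
      obtain n where n: "y = (\<sigma> ^^ n) x" using reachable[of x y] x y B' block_subset by blast
      with y have "q dvd n" using short_block_mem_iff[OF B x vq] by blast
      with q(2) have "even n" by (rule dvd_trans)
      then show ?thesis unfolding n pow by simp
    qed
    then have "(\<Sum>y\<in>B. s y) = int k * s x" using card_block[OF B'] by simp
    then show ?thesis unfolding w_def by (simp add: power_mult_distrib s(2))
  qed
  then have "(\<Sum>B\<in>short_blocks. w B) = int k * int v"
    using short by (simp add: vq power2_eq_square)
  then have "int v * (\<Sum>B\<in>Q. w B) = int v * (2 * int k)"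
    using sum.subset_diff[OF short_blocks_subset finite_blocks, of w] sum_w Q(3)
    by (auto simp: algebra_simps)
  then have sum_Q: "(\<Sum>B\<in>Q. w B) = 2 * int k" using v_pos by simp
  obtain B1 B2 B3 where "Q = {B1, B2, B3}" "B1 \<noteq> B2" "B1 \<noteq> B3" "B2 \<noteq> B3"
    using card_Q by (auto simp: card_3_iff)
  with sum_Q have "w B1 + w B2 + w B3 = 2 * int k" by simp
  then show ?thesis unfolding w_def by blast
qed

end

section \<open>Nonexistence\<close>

theorem theorem5p2:
  fixes k a b :: nat
  assumes "k = 2 ^ a * (8 * b + 7)" and "odd a"
  shows "\<not> (\<exists>(V :: 'a set) \<B>. cyclic_steiner_2_design V \<B> k (3 * k * (k - 1) + k))"
proof
  assume "\<exists>(V :: 'a set) \<B>. cyclic_steiner_2_design V \<B> k (3 * k * (k - 1) + k)"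
  then obtain V :: "'a set" and \<B> \<sigma> where
    "steiner_2_design V \<B> k (3 * k * (k - 1) + k)"
    "\<sigma> permutes V" "cyclic_on \<sigma> V" "\<forall>B\<in>\<B>. \<sigma> ` B \<in> \<B>"
    unfolding cyclic_steiner_2_design_def by blast
  then interpret cyclic_design V \<B> k "3 * k * (k - 1) + k" \<sigma>
    by unfold_locales auto
  obtain m where a: "a = 2 * m + 1" using \<open>odd a\<close> by (rule oddE)
  have k: "even k" "2 \<le> k" using assms(1) a by auto
  have "3 * k * (k - 1) + k = k * (3 * k - 2)"
    using k(2) by (simp add: algebra_simps diff_mult_distrib2)
  then obtain x y z :: int where "x\<^sup>2 + y\<^sup>2 + z\<^sup>2 = 2 * int k"
    using three_squares k by blast
  moreover have "2 * int k = 4 ^ (m + 1) * (8 * int b + 7)"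
    using assms(1) a by (simp add: power_mult)
  ultimately show False using not_sum_of_three_squares by metis
qed

end
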